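(* There exists a finitely presented $2$-generated group that is not free and is $k$-free-like for every integer $k\ge 2$; and there exists a $2$-generated group that is not finitely presented, is not free, and is $k$-free-like for every integer $k\ge 2$.
   Context: Let $G$ be a finitely generated group. For a finite symmetric generating set $X=X^{-1}$ of $G$ and $A\subset G$, the (inner) boundary of $A$ relative to $X$ is $\partial_X A=\{a\in A : ax\notin A \text{ for some } x\in X\}$. The Cheeger constant of $G$ with respect to $X$ is $\mathrm{Che}_X G=\inf_A \frac{\#\partial_X A}{\# A}$, where $A$ runs over all nonempty finite subsets of $G$. For a finite generating set $Z$ of $G$ (not necessarily symmetric), $\mathrm{Cayley}(G,Z)$ is the Cayley graph, with one edge joining $g$ and $gz$ for each $g\in G$, $z\in Z$ (loops and multiple edges allowed). Its Cheeger constant is $\mathrm{Che}_{Z\cup Z^{-1}}G$. Its girth is the minimal length of a simple loop in the graph, i.e. the minimal length of a non-empty reduced group word in the elements of $Z$ (treated as independent letters) that equals $1$ in $G$; the girth is $\infty$ if there is no such word. For an integer $k\ge 2$, $G$ is called $k$-free-like if there exist a sequence of generating sets $Z_i$ ($i\ge 1$) of $G$, each with $k$ elements, and a constant $\varepsilon>0$ such that for every $i\ge 1$ the graph $\mathrm{Cayley}(G,Z_i)$ has girth at least $i$ and Cheeger constant at least $\varepsilon$. *)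

theory Defs
  imports Complex_Main "HOL-Library.Extended_Nat" "HOL-Algebra.Generated_Groups"
begin

text \<open>
  Group words over an alphabet: \<open>(x, True)\<close> stands for the letter \<open>x\<close>
  and \<open>(x, False)\<close> for its formal inverse.
\<close>

type_synonym 'a word = "('a \<times> bool) list"

definition inv_letter :: "'a \<times> bool \<Rightarrow> 'a \<times> bool"
  where "inv_letter l = (fst l, \<not> snd l)"

definition reduced_words :: "'a set \<Rightarrow> 'a word set"
  where "reduced_words S =
    {w. fst ` set w \<subseteq> S \<and> successively (\<lambda>l m. m \<noteq> inv_letter l) w}"

text \<open>Left multiplication of a reduced word by a letter.\<close>

definition push_letter :: "'a \<times> bool \<Rightarrow> 'a word \<Rightarrow> 'a word"
  where "push_letter l w =
    (case w of [] \<Rightarrow> [l] | m # v \<Rightarrow> (if m = inv_letter l then v else l # w))"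

definition free_group :: "'a set \<Rightarrow> 'a word monoid"
  where "free_group S =
    \<lparr>carrier = reduced_words S, monoid.mult = (\<lambda>u v. foldr push_letter u v), one = []\<rparr>"

lemma inv_letter_inv_letter [simp]: "inv_letter (inv_letter l) = l"
  by (simp add: inv_letter_def)

lemma fst_inv_letter [simp]: "fst (inv_letter l) = fst l"
  by (simp add: inv_letter_def)

lemma push_letter_closed:
  assumes "fst l \<in> S" "w \<in> reduced_words S"
  shows "push_letter l w \<in> reduced_words S"
  using assms
  by (cases w) (auto simp: push_letter_def reduced_words_def successively_Cons)

lemma push_letter_cancel:
  assumes "w \<in> reduced_words S"
  shows "push_letter l (push_letter (inv_letter l) w) = w"
  using assms
  by (cases w; cases "tl w")
    (auto simp: push_letter_def reduced_words_def)

lemma foldr_push_letter_closed: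
  assumes "fst ` set u \<subseteq> S" "w \<in> reduced_words S"
  shows "foldr push_letter u w \<in> reduced_words S"
  using assms by (induction u) (auto intro: push_letter_closed)

lemma foldr_push_letter_push_letter:
  assumes "fst l \<in> S" "u \<in> reduced_words S" "w \<in> reduced_words S"
  shows "foldr push_letter (push_letter l u) w = push_letter l (foldr push_letter u w)"
proof (cases "\<exists>v. u = inv_letter l # v")
  case True
  then obtain v where v: "u = inv_letter l # v" by blast
  have "foldr push_letter v w \<in> reduced_words S"
    using assms v by (intro foldr_push_letter_closed) (auto simp: reduced_words_def)
  then show ?thesis
    using v by (simp add: push_letter_cancel) (simp add: push_letter_def)
next
  case False
  then have "push_letter l u = l # u"
    by (cases u) (auto simp: push_letter_def)
  then show ?thesis by simp
qed

lemma foldr_push_letter_assoc: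
  assumes "fst ` set u \<subseteq> S" "v \<in> reduced_words S" "w \<in> reduced_words S"
  shows "foldr push_letter (foldr push_letter u v) w =
    foldr push_letter u (foldr push_letter v w)"
  using assms
  by (induction u)
    (auto simp: foldr_push_letter_push_letter foldr_push_letter_closed)

lemma foldr_push_letter_inverse:
  "foldr push_letter (rev (map inv_letter u)) u = []"
  by (induction u) (auto simp: push_letter_def)

lemma rev_map_inv_letter_reduced:
  assumes "u \<in> reduced_words S"
  shows "rev (map inv_letter u) \<in> reduced_words S"
proof -
  have "successively (\<lambda>l m. inv_letter l \<noteq> inv_letter (inv_letter m)) u"
    using assms unfolding reduced_words_def
    by (auto elim!: successively_mono)
  then show ?thesis
    using assms by (auto simp: reduced_words_def successively_map)
qed

lemma group_free_group: "group (free_group S)"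
proof (rule groupI)
  fix u assume u: "u \<in> carrier (free_group S)"
  show "\<exists>v\<in>carrier (free_group S). v \<otimes>\<^bsub>free_group S\<^esub> u = \<one>\<^bsub>free_group S\<^esub>"
    using u rev_map_inv_letter_reduced[of u S] foldr_push_letter_inverse[of u]
    by (auto simp: free_group_def)
next
  fix u v w
  assume "u \<in> carrier (free_group S)" "v \<in> carrier (free_group S)" "w \<in> carrier (free_group S)"
  then show "u \<otimes>\<^bsub>free_group S\<^esub> v \<otimes>\<^bsub>free_group S\<^esub> w =
      u \<otimes>\<^bsub>free_group S\<^esub> (v \<otimes>\<^bsub>free_group S\<^esub> w)"
    using foldr_push_letter_assoc[of u S v w]
    by (auto simp: free_group_def reduced_words_def)
next
  fix u v
  assume "u \<in> carrier (free_group S)" "v \<in> carrier (free_group S)"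
  then show "u \<otimes>\<^bsub>free_group S\<^esub> v \<in> carrier (free_group S)"
    using foldr_push_letter_closed[of u S v]
    by (auto simp: free_group_def reduced_words_def)
qed (auto simp: free_group_def reduced_words_def)

text \<open>
  A free group contains its free bases, so it suffices to let \<open>S\<close> range over
  subsets of the carrier; \<open>S = {}\<close> gives the trivial group.
\<close>

definition is_free_group :: "('a, 'b) monoid_scheme \<Rightarrow> bool"
  where "is_free_group G \<longleftrightarrow> (\<exists>S \<subseteq> carrier G. free_group S \<cong> G)"

definition normal_closure :: "('a, 'b) monoid_scheme \<Rightarrow> 'a set \<Rightarrow> 'a set"
  where "normal_closure G R = \<Inter>{N. N \<lhd> G \<and> R \<subseteq> N}"

definition finitely_presented :: "('a, 'b) monoid_scheme \<Rightarrow> bool"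
  where "finitely_presented G \<longleftrightarrow>
    (\<exists>(n::nat) R. finite R \<and> R \<subseteq> carrier (free_group {..<n}) \<and>
       free_group {..<n} Mod normal_closure (free_group {..<n}) R \<cong> G)"

definition n_generated :: "nat \<Rightarrow> ('a, 'b) monoid_scheme \<Rightarrow> bool"
  where "n_generated n G \<longleftrightarrow>
    (\<exists>X \<subseteq> carrier G. finite X \<and> card X \<le> n \<and> generate G X = carrier G)"

definition inner_boundary :: "('a, 'b) monoid_scheme \<Rightarrow> 'a set \<Rightarrow> 'a set \<Rightarrow> 'a set"
  where "inner_boundary G X A = {a \<in> A. \<exists>x\<in>X. a \<otimes>\<^bsub>G\<^esub> x \<notin> A}"

definition cheeger :: "('a, 'b) monoid_scheme \<Rightarrow> 'a set \<Rightarrow> real"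
  where "cheeger G X =
    (INF A \<in> {A. A \<subseteq> carrier G \<and> finite A \<and> A \<noteq> {}}.
       real (card (inner_boundary G X A)) / real (card A))"

definition cayley_cheeger :: "('a, 'b) monoid_scheme \<Rightarrow> 'a set \<Rightarrow> real"
  where "cayley_cheeger G Z = cheeger G (Z \<union> set_inv\<^bsub>G\<^esub> Z)"

definition eval_letter :: "('a, 'b) monoid_scheme \<Rightarrow> 'a \<times> bool \<Rightarrow> 'a"
  where "eval_letter G l = (if snd l then fst l else inv\<^bsub>G\<^esub> (fst l))"

definition eval_word :: "('a, 'b) monoid_scheme \<Rightarrow> 'a word \<Rightarrow> 'a"
  where "eval_word G w = foldr (\<lambda>l g. eval_letter G l \<otimes>\<^bsub>G\<^esub> g) w \<one>\<^bsub>G\<^esub>"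

text \<open>
  The elements of \<open>Z\<close> are treated as independent letters: if \<open>z\<close> and its
  inverse \<open>z'\<close> in the group are distinct elements of \<open>Z\<close>, the word \<open>z z'\<close> is
  reduced.  This matches the Cayley graph having one edge for each pair \<open>(g, z)\<close>.
  The infimum of the empty set is \<open>\<infinity>\<close>.
\<close>

definition cayley_girth :: "('a, 'b) monoid_scheme \<Rightarrow> 'a set \<Rightarrow> enat"
  where "cayley_girth G Z =
    (INF w \<in> {w \<in> reduced_words Z. w \<noteq> [] \<and> eval_word G w = \<one>\<^bsub>G\<^esub>}. enat (length w))"

definition free_like :: "nat \<Rightarrow> ('a, 'b) monoid_scheme \<Rightarrow> bool"
  where "free_like k G \<longleftrightarrow>
    (\<exists>(Z :: nat \<Rightarrow> 'a set) (\<epsilon> :: real). \<epsilon> > 0 \<and>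
      (\<forall>i\<ge>1. Z i \<subseteq> carrier G \<and> finite (Z i) \<and> card (Z i) = k \<and>
         generate G (Z i) = carrier G \<and>
         cayley_girth G (Z i) \<ge> enat i \<and> cayley_cheeger G (Z i) \<ge> \<epsilon>))"

end

theory Submission
  imports Defs "HOL-Combinatorics.Transposition" "HOL-Library.Countable_Set"
begin

text \<open>
  Let \<open>G\<close> be generated by \<open>a\<close> and \<open>b\<close>, and suppose that \<open>W \<subseteq> G\<close> contains \<open>1\<close>, that \<open>a\<^sup>n\<close> with
  \<open>n \<noteq> 0\<close> maps \<open>W\<close> into its complement and that \<open>b\<close> and \<open>b\<^sup>-\<^sup>1\<close> map the complement into \<open>W\<close>. The
  translates \<open>a\<^sup>n W\<close> are then disjoint. For large \<open>L\<close>, the elements \<open>a\<close> and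
  \<open>a\<^bsup>jL\<^esup> b a\<^bsup>jL\<^esup>\<close>, \<open>1 \<le> j < k\<close>, generate \<open>G\<close>, and since a short word cannot bridge the gaps between the
  multiples of \<open>L\<close>, a nonempty reduced word of length less than \<open>L\<close> maps \<open>1\<close> out of \<open>W\<close>. With
  \<open>c = a\<^sup>L b a\<^sup>L\<close>, the map \<open>g \<mapsto> a g\<close> on \<open>a\<^bsup>-L\<^esup> W\<close>, \<open>g \<mapsto> c g\<close> elsewhere, and its composite with \<open>a\<close>
  are injective with disjoint ranges; this bounds all Cheeger constants below by \<open>1/3\<close>.

  The hypothesis holds in \<open>SL\<^sub>2(\<int>)\<close> for \<open>a(x, y) = (x + 4y, y)\<close> and \<open>b(x, y) = (-y, x - y)\<close> by
  ping-pong on \<open>\<bar>x\<bar> < 2\<bar>y\<bar>\<close>, hence in every group with generators \<open>a\<close>, \<open>b\<close> that maps onto this one.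
  The finitely presented example is \<open>\<langle>a, b | b\<^sup>3\<rangle>\<close>. For \<open>S \<subseteq> \<nat>\<close>, let \<open>a\<close> and \<open>b\<close> also act on copies of
  \<open>\<int>\<close> indexed by \<open>\<nat>\<close>, \<open>a\<close> as the unit shift and \<open>b\<close> on the \<open>n\<close>-th copy as the transposition of \<open>0\<close>
  and \<open>n + 1\<close> if \<open>n \<in> S\<close>, trivially otherwise. In the resulting group, \<open>b\<^sup>3\<close> commutes with its conjugate by
  \<open>a\<^bsup>n+1\<^esup>\<close> iff \<open>n \<notin> S\<close>, so there are uncountably many kernels, whereas only countably many of them
  have a finitely presented quotient. None of these groups is free, because \<open>b\<close> has finite order.
\<close>

section \<open>Free groups\<close>

lemma reduced_words_ConsD: "l # w \<in> reduced_words S \<Longrightarrow> w \<in> reduced_words S"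
  by (auto simp: reduced_words_def successively_Cons)

lemma foldr_push_letter_append:
  "u @ v \<in> reduced_words S \<Longrightarrow> foldr push_letter u v = u @ v"
proof (induction u)
  case (Cons l u)
  have "u @ v \<in> reduced_words S"
    using Cons.prems by (auto dest: reduced_words_ConsD)
  moreover have "push_letter l (u @ v) = l # (u @ v)"
    using Cons.prems
    by (cases "u @ v") (auto simp: push_letter_def reduced_words_def successively_Cons)
  ultimately show ?case
    using Cons.IH by simp
qed simp

lemma free_group_simps [simp]:
  "carrier (free_group S) = reduced_words S"
  "u \<otimes>\<^bsub>free_group S\<^esub> v = foldr push_letter u v"
  "\<one>\<^bsub>free_group S\<^esub> = []"
  by (simp_all add: free_group_def)

lemma Nil_reduced [simp]: "[] \<in> reduced_words S"
  by (simp add: reduced_words_def)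

lemma letter_reduced [simp]: "[l] \<in> reduced_words S \<longleftrightarrow> fst l \<in> S"
  by (auto simp: reduced_words_def)

lemma inv_letter_free_group:
  assumes "i \<in> S"
  shows "inv\<^bsub>free_group S\<^esub> [(i, e)] = [(i, \<not> e)]"
proof -
  interpret F: group "free_group S" by (rule group_free_group)
  have "[(i, \<not> e)] \<otimes>\<^bsub>free_group S\<^esub> [(i, e)] = \<one>\<^bsub>free_group S\<^esub>"
    by (simp add: push_letter_def inv_letter_def)
  then show ?thesis
    using assms F.inv_equality[of "[(i, \<not> e)]" "[(i, e)]"] by simp
qed

lemma eval_word_simps [simp]:
  "eval_word G [] = \<one>\<^bsub>G\<^esub>"
  "eval_word G (l # w) = eval_letter G l \<otimes>\<^bsub>G\<^esub> eval_word G w"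
  by (simp_all add: eval_word_def)

text \<open>The images of the letters determine the homomorphism. This gives generation of quotients
  by two elements and allows a kernel to be encoded by two images.\<close>

lemma hom_free_group_eval_word:
  assumes H: "group H" and h: "h \<in> hom (free_group S) H" and w: "w \<in> reduced_words S"
  shows "h w = eval_word H (map (apfst (\<lambda>i. h [(i, True)])) w)"
proof -
  interpret group_hom "free_group S" H h
    using H h group_free_group by (simp add: group_hom_def group_hom_axioms_def)
  show ?thesis
    using w
  proof (induction w)
    case Nil
    then show ?case using hom_one by simp
  next
    case (Cons l w)
    obtain i e where l: "l = (i, e)" by (cases l)
    have i: "i \<in> S" using Cons.prems l by (auto simp: reduced_words_def)
    have w: "w \<in> reduced_words S" using Cons.prems by (rule reduced_words_ConsD)
    have "h [(i, e)] = eval_letter H (h [(i, True)], e)"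
    proof (cases e)
      case False
      have "h (inv\<^bsub>free_group S\<^esub> [(i, True)]) = inv\<^bsub>H\<^esub> h [(i, True)]"
        by (rule hom_inv) (use i in simp)
      then show ?thesis
        using False i by (simp add: eval_letter_def inv_letter_free_group)
    qed (simp add: eval_letter_def)
    moreover have "h (l # w) = h [l] \<otimes>\<^bsub>H\<^esub> h w"
      using hom_mult[of "[l]" w] foldr_push_letter_append[of "[l]" w S] Cons.prems i l w by simp
    ultimately show ?case
      using Cons.IH w l by simp
  qed
qed

lemma (in group) eval_letter_closed [simp]:
  "fst l \<in> carrier G \<Longrightarrow> eval_letter G l \<in> carrier G"
  by (simp add: eval_letter_def)

lemma (in group) eval_word_in_generate:
  "fst ` set w \<subseteq> Z \<Longrightarrow> eval_word G w \<in> generate G Z"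
proof (induction w)
  case (Cons l w)
  then have "eval_letter G l \<in> generate G Z"
    by (auto simp: eval_letter_def intro: generate.incl generate.inv)
  then show ?case
    using Cons by (auto intro: generate.eng)
qed (simp add: generate.one)

section \<open>Torsion-freeness of free groups\<close>

lemma concat_replicate_reduced:
  assumes "w \<in> reduced_words S" "w \<noteq> []" "hd w \<noteq> inv_letter (last w)"
  shows "concat (replicate n w) \<in> reduced_words S"
proof (induction n)
  case (Suc n)
  have "concat (replicate n w) = [] \<or> hd (concat (replicate n w)) = hd w"
    using assms(2) by (cases n) auto
  then show ?case
    using Suc assms
    by (auto simp: reduced_words_def successively_append_iff)
qed simp

text \<open>The condition on \<open>hd w\<close> and \<open>last w\<close> says that
  \<open>w\<close> is cyclically reduced: nothing cancels where consecutive copies meet.\<close>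

lemma free_group_pow_cyclically_reduced:
  assumes "w \<in> reduced_words S" "w \<noteq> []" "hd w \<noteq> inv_letter (last w)"
  shows "w [^]\<^bsub>free_group S\<^esub> n = concat (replicate n w)"
proof (induction n)
  case (Suc n)
  have "concat (replicate n w) @ w = concat (replicate (Suc n) w)"
    by (induction n) auto
  then have "concat (replicate n w) @ w \<in> reduced_words S"
    using concat_replicate_reduced[OF assms, of "Suc n"] by simp
  then show ?case
    using Suc foldr_push_letter_append[of "concat (replicate n w)" w S]
      \<open>concat (replicate n w) @ w = _\<close> by simp
qed simp

lemma (in group) conj_eq_oneD:
  assumes "x \<in> carrier G" "y \<in> carrier G" "x \<otimes> y \<otimes> inv x = \<one>"
  shows "y = \<one>"
proof -
  have "x \<otimes> y = x"
    using assms inv_solve_right[of \<one> "x \<otimes> y" x] by simp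
  then show ?thesis
    using assms by simp
qed

lemma (in group) conj_nat_pow:
  assumes "x \<in> carrier G" "y \<in> carrier G"
  shows "(x \<otimes> y \<otimes> inv x) [^] (n::nat) = x \<otimes> y [^] n \<otimes> inv x"
proof (induction n)
  case (Suc n)
  then show ?case
    using assms by (simp add: m_assoc inv_solve_left)
      (simp add: m_assoc[symmetric] )
qed (use assms in simp)

text \<open>Induction on length. Powers of a nonempty cyclically reduced word are literal
  concatenations, hence nonempty. Any other nonempty word is a conjugate of a shorter nonempty word,
  whose power would be trivial too.\<close>

lemma free_group_torsion_free:
  assumes "w \<in> reduced_words S" "w [^]\<^bsub>free_group S\<^esub> (Suc n) = []"
  shows "w = []"
  using assms
proof (induction "length w" arbitrary: w rule: less_induct)
  case less
  interpret F: group "free_group S" by (rule group_free_group)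
  show ?case
  proof (rule ccontr)
    assume ne: "w \<noteq> []"
    show False
    proof (cases "hd w = inv_letter (last w)")
      case False
      then show ?thesis
        using less.prems ne free_group_pow_cyclically_reduced[of w S "Suc n"] by simp
    next
      case True
      define l where "l = hd w"
      obtain u where u: "w = l # u" using ne l_def by (cases w) auto
      have last_w: "last w = inv_letter l"
        using True l_def by simp
      \<comment> \<open>No letter is its own formal inverse, so \<open>w\<close> has at least two
        letters.\<close>
      have "u \<noteq> []"
        using True u by (auto simp: inv_letter_def prod_eq_iff)
      then obtain v where v: "u = v @ [inv_letter l]"
        using last_w u by (metis append_butlast_last_id last.simps)
      have w: "w = [l] @ v @ [inv_letter l]" using u v by simp
      have red: "v @ [inv_letter l] \<in> reduced_words S" "v \<in> reduced_words S" "fst l \<in> S"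
        using less.prems(1) w
        by (auto simp: reduced_words_def successively_Cons successively_append_iff)
      have inv: "inv\<^bsub>free_group S\<^esub> [l] = [inv_letter l]"
        using inv_letter_free_group[of "fst l" S "snd l"] red(3) by (simp add: inv_letter_def)
      \<comment> \<open>Otherwise \<open>w\<close> would be \<open>[l, inv_letter l]\<close>, which
        is not reduced.\<close>
      have "v \<noteq> []"
        using less.prems(1) w by (auto simp: reduced_words_def)
      have eq: "w = [l] \<otimes>\<^bsub>free_group S\<^esub> v \<otimes>\<^bsub>free_group S\<^esub> inv\<^bsub>free_group S\<^esub> [l]"
      proof -
        have "w = [l] \<otimes>\<^bsub>free_group S\<^esub> (v \<otimes>\<^bsub>free_group S\<^esub> [inv_letter l])"
          using foldr_push_letter_append[OF red(1)] less.prems(1) w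
            foldr_push_letter_append[of "[l]" "v @ [inv_letter l]" S] by simp
        then show ?thesis
          using inv red by (simp add: F.m_assoc del: free_group_simps(2)) 
      qed
      have c: "[l] \<in> carrier (free_group S)" "v \<in> carrier (free_group S)"
        using red by simp_all
      have "[l] \<otimes>\<^bsub>free_group S\<^esub> v [^]\<^bsub>free_group S\<^esub> Suc n \<otimes>\<^bsub>free_group S\<^esub> inv\<^bsub>free_group S\<^esub> [l]
          = \<one>\<^bsub>free_group S\<^esub>"
        using less.prems(2) eq F.conj_nat_pow[OF c, of "Suc n"] by simp
      then have "v [^]\<^bsub>free_group S\<^esub> Suc n = \<one>\<^bsub>free_group S\<^esub>"
        by (rule F.conj_eq_oneD[OF c(1) F.nat_pow_closed[OF c(2)]])
      then have "v = []"
        using less.hyps[of v] w red by simp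
      then show False using \<open>v \<noteq> []\<close> by simp
    qed
  qed
qed

lemma not_free_if_torsion:
  fixes G :: "('a, 'b) monoid_scheme"
  assumes G: "group G" and x: "x \<in> carrier G" "x \<noteq> \<one>\<^bsub>G\<^esub>" "x [^]\<^bsub>G\<^esub> Suc n = \<one>\<^bsub>G\<^esub>"
  shows "\<not> is_free_group G"
proof
  assume "is_free_group G"
  then obtain S :: "'a set" and h where h: "h \<in> iso (free_group S) G"
    unfolding is_free_group_def is_iso_def by blast
  interpret group_hom "free_group S" G h
    using G h group_free_group by (simp add: group_hom_def group_hom_axioms_def iso_def)
  have "x \<in> h ` carrier (free_group S)"
    using h x(1) by (simp add: iso_def bij_betw_def)
  then obtain w where w: "w \<in> carrier (free_group S)" "h w = x"
    by blast
  have "h (w [^]\<^bsub>free_group S\<^esub> Suc n) = h \<one>\<^bsub>free_group S\<^esub>"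
    using w x(3) hom_nat_pow[of w "Suc n"] hom_one by simp
  then have "w [^]\<^bsub>free_group S\<^esub> Suc n = \<one>\<^bsub>free_group S\<^esub>"
    using h by (intro inj_onD[of h "carrier (free_group S)"] G.nat_pow_closed w(1) G.one_closed)
      (simp_all add: iso_def bij_betw_def)
  then have "w = []"
    using free_group_torsion_free[of w S n] w(1) by simp
  then show False
    using w(2) x(2) hom_one by simp
qed

section \<open>Ping-pong with long-range generators\<close>

locale ping_pong_group = group G for G (structure) +
  fixes a b :: 'a and W :: "'a set"
  assumes a [simp, intro]: "a \<in> carrier G" and b [simp, intro]: "b \<in> carrier G"
    and generate_ab: "generate G {a, b} = carrier G"
    and one_W: "\<one> \<in> W"
    and pow_a_W: "g \<in> carrier G \<Longrightarrow> g \<in> W \<Longrightarrow> n \<noteq> 0 \<Longrightarrow> a [^] (n::int) \<otimes> g \<notin> W"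
    and b_W: "g \<in> carrier G \<Longrightarrow> g \<notin> W \<Longrightarrow> b \<otimes> g \<in> W"
    and inv_b_W: "g \<in> carrier G \<Longrightarrow> g \<notin> W \<Longrightarrow> inv b \<otimes> g \<in> W"
begin

text \<open>This is the translate \<open>a^n W\<close>. Levels are disjoint but need not cover the
  group, so a point may have no level at all.\<close>

definition level :: "int \<Rightarrow> 'a set"
  where "level n = {g \<in> carrier G. a [^] (- n) \<otimes> g \<in> W}"

lemma a_pow_mult: "g \<in> carrier G \<Longrightarrow> a [^] (m::int) \<otimes> (a [^] (n::int) \<otimes> g) = a [^] (m + n) \<otimes> g"
  by (simp add: int_pow_mult m_assoc)

lemma a_pow_level: "g \<in> level m \<Longrightarrow> a [^] n \<otimes> g \<in> level (m + n)"
  by (simp add: level_def a_pow_mult)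

lemma a_level: "g \<in> level m \<Longrightarrow> a \<otimes> g \<in> level (m + 1)"
  using a_pow_level[of g m 1] by simp

lemma inv_a_level: "g \<in> level m \<Longrightarrow> inv a \<otimes> g \<in> level (m - 1)"
  using a_pow_level[of g m "-1"] by (simp add: int_pow_neg)

lemma one_level: "\<one> \<in> level 0"
  using one_W by (simp add: level_def)

lemma level_unique:
  assumes "g \<in> level m" "g \<in> level n"
  shows "m = n"
proof (rule ccontr)
  assume "m \<noteq> n"
  then have "a [^] (m - n) \<otimes> (a [^] (- m) \<otimes> g) \<notin> W"
    using assms by (intro pow_a_W) (auto simp: level_def)
  then show False
    using assms by (simp add: level_def a_pow_mult)
qed

definition mover :: "int \<Rightarrow> 'a"
  where "mover n = a [^] n \<otimes> b \<otimes> a [^] n"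

lemma mover_closed [simp, intro]: "mover n \<in> carrier G"
  by (simp add: mover_def)

text \<open>The right factor \<open>a^n\<close> carries level \<open>-n\<close> onto
  \<open>W\<close> and its complement off \<open>W\<close>; \<open>b\<close> then sends the latter
  into \<open>W\<close>, and the left factor lifts \<open>W\<close> to level
  \<open>n\<close>.\<close>

lemma mover_level:
  assumes "g \<in> carrier G" "g \<notin> level (- n)"
  shows "mover n \<otimes> g \<in> level n"
proof -
  have "b \<otimes> (a [^] n \<otimes> g) \<in> W"
    using assms by (intro b_W) (auto simp: level_def)
  then have "b \<otimes> (a [^] n \<otimes> g) \<in> level 0"
    using assms by (simp add: level_def)
  then have "a [^] n \<otimes> (b \<otimes> (a [^] n \<otimes> g)) \<in> level (0 + n)"
    by (rule a_pow_level)
  then show ?thesis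
    using assms by (simp add: mover_def m_assoc)
qed

lemma inv_mover_level:
  assumes "g \<in> carrier G" "g \<notin> level n"
  shows "inv (mover n) \<otimes> g \<in> level (- n)"
proof -
  have "inv b \<otimes> (a [^] (- n) \<otimes> g) \<in> W"
    using assms by (intro inv_b_W) (auto simp: level_def)
  then have "inv b \<otimes> (a [^] (- n) \<otimes> g) \<in> level 0"
    using assms by (simp add: level_def)
  then have "a [^] (- n) \<otimes> (inv b \<otimes> (a [^] (- n) \<otimes> g)) \<in> level (0 + - n)"
    by (rule a_pow_level)
  moreover have "inv (mover n) = a [^] (- n) \<otimes> (inv b \<otimes> a [^] (- n))"
    by (simp add: mover_def inv_mult_group int_pow_neg)
  ultimately show ?thesis
    using assms by (simp add: m_assoc)
qed

section \<open>Girth of the generating sets\<close>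

definition gen :: "int \<Rightarrow> nat \<Rightarrow> 'a"
  where "gen L j = (if j = 0 then a else mover (int j * L))"

lemma gen_closed [simp, intro]: "gen L j \<in> carrier G"
  by (simp add: gen_def)

definition sign :: "bool \<Rightarrow> int"
  where "sign e = (if e then 1 else -1)"

lemma eval_word_gen_closed:
  "eval_word G (map (apfst (gen L)) w) \<in> carrier G"
proof (induction w)
  case (Cons l w)
  then show ?case by (cases l) (auto simp: eval_word_def eval_letter_def)
qed (simp add: eval_word_def)

text \<open>
  The level of the value of a word is \<open>m + t L\<close>, where \<open>m\<close> is the exponent of the leading power of
  \<open>a\<close> and \<open>t\<close> the signed index of the first other letter.
\<close>

lemma eval_word_gen_level:
  assumes "w \<in> reduced_words UNIV" "int (length w) < L"
  shows "\<exists>m t. eval_word G (map (apfst (gen L)) w) \<in> level (m + t * L) \<and> \<bar>m\<bar> \<le> int (length w) \<and>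
    (case w of [] \<Rightarrow> m = 0 \<and> t = 0
     | (j, e) # v \<Rightarrow> if j = 0 then sign e * m \<ge> 1 else m = 0 \<and> t = sign e * int j)"
  using assms
proof (induction w)
  case Nil
  then show ?case
    using one_level by (auto simp: eval_word_def intro!: exI[of _ 0])
next
  case (Cons l w)
  let ?g = "eval_word G (map (apfst (gen L)) w)"
  obtain j e where l: "l = (j, e)" by (cases l)
  have red: "w \<in> reduced_words UNIV" "w \<noteq> [] \<Longrightarrow> hd w \<noteq> (j, \<not> e)"
    using Cons.prems(1) l by (auto simp: reduced_words_def successively_Cons inv_letter_def)
  obtain m t where mt: "?g \<in> level (m + t * L)" "\<bar>m\<bar> \<le> int (length w)"
    and first: "case w of [] \<Rightarrow> m = 0 \<and> t = 0
       | (j, e) # v \<Rightarrow> if j = 0 then sign e * m \<ge> 1 else m = 0 \<and> t = sign e * int j"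
    using Cons.IH red(1) Cons.prems(2) by auto
  have ev: "eval_word G (map (apfst (gen L)) (l # w)) = eval_letter G (gen L j, e) \<otimes> ?g"
    using l by (simp add: eval_word_def)
  show ?case
  proof (cases "j = 0")
    case True
    have "eval_letter G (gen L j, e) \<otimes> ?g \<in> level ((m + sign e) + t * L)"
      using a_level[OF mt(1)] inv_a_level[OF mt(1)] True
      by (auto simp: eval_letter_def gen_def sign_def algebra_simps)
    \<comment> \<open>If \<open>w\<close> also starts with a power of \<open>a\<close>, reducedness
      forces the same sign, so the exponents accumulate; otherwise \<open>m = 0\<close>.\<close>
    moreover have "sign e * (m + sign e) \<ge> 1"
      using first red(2) True
      by (cases w) (auto simp: sign_def split: prod.splits if_splits)
    ultimately show ?thesis
      using mt(2) l True unfolding ev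
      by (intro exI[of _ "m + sign e"] exI[of _ t]) (auto simp: sign_def)
  next
    case False
    have L: "L > 0" "\<bar>m\<bar> < L" using Cons.prems(2) mt(2) by auto
    \<comment> \<open>Equality would make \<open>m\<close> a multiple of \<open>L\<close> with
      \<open>\<bar>m\<bar> < L\<close>, so \<open>m = 0\<close> and
      \<open>t = - sign e * int j\<close>. As \<open>j\<close> is nonzero, \<open>w\<close> would
      then start with the inverse of the new letter, against reducedness.\<close>
    have neq: "m + t * L \<noteq> - (sign e * int j * L)"
    proof
      assume "m + t * L = - (sign e * int j * L)"
      then have m: "m = (- sign e * int j - t) * L" by (simp add: algebra_simps)
      then have "\<bar>- sign e * int j - t\<bar> * L < 1 * L" using L by (simp add: abs_mult)
      then have "\<bar>- sign e * int j - t\<bar> < 1" using L by (simp only: mult_less_cancel_right)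
      then have t: "t = - sign e * int j" and m0: "m = 0" using m by auto
      then show False
        using first red(2) False
        by (cases w) (auto simp: sign_def split: prod.splits if_splits)
    qed
    have "?g \<notin> level (- (sign e * int j * L))"
      using level_unique[OF mt(1)] neq by blast
    then have "eval_letter G (gen L j, e) \<otimes> ?g \<in> level (0 + (sign e * int j) * L)"
      using mover_level[of ?g "int j * L"] inv_mover_level[of ?g "int j * L"] False
        eval_word_gen_closed[of L w]
      by (auto simp: eval_letter_def gen_def sign_def)
    then show ?thesis
      using l False unfolding ev
      by (intro exI[of _ 0] exI[of _ "sign e * int j"]) auto
  qed
qed

text \<open>The identity has level \<open>0\<close>, and \<open>\<bar>m\<bar> < L\<close> then
  forces \<open>m = t = 0\<close>; but the first letter of a nonempty word makes \<open>m\<close> or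
  \<open>t\<close> nonzero.\<close>

lemma eval_word_gen_neq_one:
  assumes "w \<in> reduced_words UNIV" "int (length w) < L" "w \<noteq> []"
  shows "eval_word G (map (apfst (gen L)) w) \<noteq> \<one>"
proof
  assume one: "eval_word G (map (apfst (gen L)) w) = \<one>"
  obtain m t where mt: "\<one> \<in> level (m + t * L)" "\<bar>m\<bar> \<le> int (length w)"
    and first: "case w of [] \<Rightarrow> m = 0 \<and> t = 0
       | (j, e) # v \<Rightarrow> if j = 0 then sign e * m \<ge> 1 else m = 0 \<and> t = sign e * int j"
    using eval_word_gen_level[OF assms(1,2)] one by auto
  have L: "L > 0" "\<bar>m\<bar> < L" using assms(2) mt(2) by auto
  have "m + t * L = 0"
    using level_unique[OF mt(1) one_level] .
  then have m: "m = (- t) * L" by simp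
  then have "\<bar>- t\<bar> * L < 1 * L" using L by (simp add: abs_mult)
  then have "\<bar>- t\<bar> < 1" using L by (simp only: mult_less_cancel_right)
  then have "t = 0" "m = 0" using m by auto
  then show False
    using first assms(3) by (cases w) (auto simp: sign_def split: prod.splits if_splits)
qed

text \<open>Two equal generators would give a relation of length two, shorter than
  \<open>L\<close>.\<close>

lemma inj_gen:
  assumes "L > 2"
  shows "inj (gen L)"
proof
  fix i j assume "gen L i = gen L j"
  then have "eval_word G (map (apfst (gen L)) [(i, True), (j, False)]) = \<one>"
    by (simp add: eval_word_def eval_letter_def)
  then have "[(i, True), (j, False)] \<notin> reduced_words UNIV"
    using eval_word_gen_neq_one[of "[(i, True), (j, False)]" L] assms by auto
  then show "i = j"
    by (auto simp: reduced_words_def inv_letter_def)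
qed

lemma girth_gen:
  assumes "L > 2"
  shows "cayley_girth G (gen L ` {..<k}) \<ge> enat (nat L)"
  unfolding cayley_girth_def
proof (rule INF_greatest)
  fix w assume w: "w \<in> {w \<in> reduced_words (gen L ` {..<k}). w \<noteq> [] \<and> eval_word G w = \<one>}"
  \<comment> \<open>Girth is about words in group elements, the level argument about words in
    indices. A cancelling pair in \<open>v\<close> would map to a cancelling pair in
    \<open>w\<close>, so \<open>v\<close> is reduced as well.\<close>
  define v where "v = map (apfst (inv_into UNIV (gen L))) w"
  have inv_gen: "gen L (inv_into UNIV (gen L) z) = z" if "z \<in> gen L ` {..<k}" for z
    using that by (auto simp: f_inv_into_f)
  have w_v: "w = map (apfst (gen L)) v"
    using w inv_gen unfolding v_def
    by (auto simp: reduced_words_def intro!: map_idI[symmetric])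
  moreover have "successively (\<lambda>l m. m \<noteq> inv_letter l) v"
    using w unfolding w_v
    by (auto simp: reduced_words_def successively_map inv_letter_def elim!: successively_mono)
  then have "v \<in> reduced_words UNIV"
    by (simp add: reduced_words_def)
  ultimately have "\<not> int (length v) < L"
    using w eval_word_gen_neq_one[of v L] by auto
  then show "enat (nat L) \<le> enat (length w)"
    by (simp add: v_def)
qed

text \<open>Indices \<open>0\<close> and \<open>1\<close> already suffice: \<open>b\<close> is
  recovered from \<open>mover L\<close> by multiplying with \<open>a^(-L)\<close> on both
  sides.\<close>

lemma generate_gen:
  assumes "k \<ge> 2"
  shows "generate G (gen L ` {..<k}) = carrier G"
proof -
  let ?H = "generate G (gen L ` {..<k})"
  have H: "subgroup ?H G"
    by (rule generate_is_subgroup) auto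
  have "gen L 0 \<in> ?H" "gen L 1 \<in> ?H"
    using assms by (auto intro!: generate.incl)
  then have aH: "a \<in> ?H" and cH: "mover L \<in> ?H"
    by (simp_all add: gen_def)
  have pow: "a [^] n \<in> ?H" for n :: int
    using H aH by (rule subgroup_int_pow_closed)
  have "a [^] (- L) \<otimes> mover L \<otimes> a [^] (- L) \<in> ?H"
    using H pow cH by (intro subgroup.m_closed)
  moreover have "a [^] (- L) \<otimes> mover L \<otimes> a [^] (- L) = b"
    by (simp add: mover_def m_assoc int_pow_neg l_inv) (simp flip: m_assoc)
  ultimately have "generate G {a, b} \<subseteq> ?H"
    using aH H by (intro generate_subgroup_incl) auto
  moreover have "?H \<subseteq> carrier G"
    using H by (rule subgroup.subset)
  ultimately show ?thesis
    using generate_ab by auto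
qed

end

section \<open>Cheeger constants via a doubling argument\<close>

text \<open>
  Two injective maps with disjoint ranges that move points along boundedly many edges: a set with
  a small boundary would be mapped into itself twice.
\<close>

lemma doubling_boundary:
  fixes f h :: "'g \<Rightarrow> 'g"
  assumes A: "finite A" and B: "B \<subseteq> A"
    and inj: "inj_on f A" "inj_on h A" and disj: "f ` A \<inter> h ` A = {}"
    and f: "\<And>x. x \<in> A - B \<Longrightarrow> f x \<in> A"
    and h: "\<And>x. x \<in> A - B \<Longrightarrow> f x \<in> A - B \<Longrightarrow> h x \<in> A"
  shows "card A \<le> 3 * card B"
proof -
  \<comment> \<open>\<open>I\<close> is the interior, and \<open>J\<close> consists of the points
    that \<open>f\<close> keeps in the interior. The points of \<open>I - J\<close> are sent
    injectively into \<open>B\<close>.\<close>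
  define I J where "I = A - B" and "J = {x \<in> I. f x \<notin> B}"
  have sub: "J \<subseteq> I" "I \<subseteq> A" "I - J \<subseteq> A" "J \<subseteq> A"
    by (auto simp: I_def J_def)
  have fin: "finite B" "finite I" "finite J"
    using A B sub by (auto intro: finite_subset)
  have I: "card I = card A - card B"
    unfolding I_def by (rule card_Diff_subset[OF fin(1) B])
  have "card (I - J) = card (f ` (I - J))"
    using card_image[OF inj_on_subset[OF inj(1) sub(3)]] by simp
  also have "f ` (I - J) \<subseteq> B"
    by (auto simp: J_def)
  then have "card (f ` (I - J)) \<le> card B"
    by (rule card_mono[OF fin(1)])
  finally have J: "card I - card J \<le> card B"
    by (simp add: card_Diff_subset[OF fin(3) sub(1)])
  have "f ` I \<inter> h ` J = {}"
    using disj sub by blast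
  then have "card (f ` I \<union> h ` J) = card (f ` I) + card (h ` J)"
    using fin by (intro card_Un_disjoint) auto
  also have "\<dots> = card I + card J"
    using card_image[OF inj_on_subset[OF inj(1) sub(2)]] card_image[OF inj_on_subset[OF inj(2) sub(4)]]
    by simp
  finally have "card I + card J = card (f ` I \<union> h ` J)" ..
  also have "f ` I \<union> h ` J \<subseteq> A"
  proof -
    have "f x \<in> A" if "x \<in> I" for x using f that by (simp add: I_def)
    moreover have "h x \<in> A" if "x \<in> J" for x
      using f h that by (simp add: I_def J_def)
    ultimately show ?thesis by blast
  qed
  then have "card (f ` I \<union> h ` J) \<le> card A"
    by (rule card_mono[OF A])
  \<comment> \<open>With \<open>|I| = |A| - |B|\<close> and \<open>|J| \<ge> |I| - |B|\<close>, the
    bound \<open>|I| + |J| \<le> |A|\<close> becomes \<open>2|A| - 3|B| \<le> |A|\<close>.\<close>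
  finally show ?thesis
    using I J card_mono[OF A B] by linarith
qed

context ping_pong_group
begin

text \<open>Level \<open>-L\<close> is exactly where \<open>mover_level\<close> gives no control, so
  \<open>a\<close> is used there instead.\<close>

definition shift :: "int \<Rightarrow> 'a \<Rightarrow> 'a"
  where "shift L g = (if g \<in> level (- L) then a \<otimes> g else mover L \<otimes> g)"

lemma shift_closed [simp, intro]: "g \<in> carrier G \<Longrightarrow> shift L g \<in> carrier G"
  by (simp add: shift_def)

lemma shift_level:
  assumes "g \<in> carrier G"
  shows "shift L g \<in> level (if g \<in> level (- L) then 1 - L else L)"
  using assms a_level[of g "- L"] mover_level[of g L] by (auto simp: shift_def)

text \<open>The level of the image, \<open>1 - L\<close> or \<open>L\<close>, reveals which branch
  was taken, and each branch is a left multiplication.\<close>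

lemma inj_on_shift: "inj_on (shift L) (carrier G)"
proof
  fix g h assume gh: "g \<in> carrier G" "h \<in> carrier G" and eq: "shift L g = shift L h"
  have "(if g \<in> level (- L) then 1 - L else L) = (if h \<in> level (- L) then 1 - L else L)"
    using shift_level[OF gh(1), of L] shift_level[OF gh(2), of L] eq by (auto dest: level_unique)
  moreover have "1 - L \<noteq> L" by presburger
  ultimately have "g \<in> level (- L) \<longleftrightarrow> h \<in> level (- L)"
    by (auto split: if_splits)
  then show "g = h"
    using eq gh by (auto simp: shift_def split: if_splits)
qed

text \<open>The left side has level \<open>1 - L\<close> or \<open>L\<close>, the right side
  \<open>2 - L\<close> or \<open>L + 1\<close>; these are disjoint pairs once
  \<open>L > 1\<close>.\<close>

lemma shift_neq_a_shift:
  assumes "L > 1" "g \<in> carrier G" "h \<in> carrier G"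
  shows "shift L g \<noteq> a \<otimes> shift L h"
proof
  assume eq: "shift L g = a \<otimes> shift L h"
  have "a \<otimes> shift L h \<in> level ((if h \<in> level (- L) then 1 - L else L) + 1)"
    by (rule a_level[OF shift_level[OF assms(3)]])
  then have "(if g \<in> level (- L) then 1 - L else L) = (if h \<in> level (- L) then 1 - L else L) + 1"
    using level_unique[OF shift_level[OF assms(2)]] eq by simp
  then show False
    using assms(1) by (simp split: if_splits)
qed

lemma cheeger_gen:
  assumes "k \<ge> 2" "L > 1"
  shows "cayley_cheeger G (gen L ` {..<k}) \<ge> 1 / 3"
  unfolding cayley_cheeger_def cheeger_def
proof (rule cINF_greatest)
  show "{A. A \<subseteq> carrier G \<and> finite A \<and> A \<noteq> {}} \<noteq> {}"
    by (auto intro!: exI[of _ "{\<one>}"])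
next
  fix A assume "A \<in> {A. A \<subseteq> carrier G \<and> finite A \<and> A \<noteq> {}}"
  then have A: "A \<subseteq> carrier G" "finite A" "A \<noteq> {}" by auto
  define X where "X = gen L ` {..<k} \<union> set_inv (gen L ` {..<k})"
  let ?B = "inner_boundary G X A"
  \<comment> \<open>Edges of the Cayley graph are right multiplications, so the left-sided maps are
    conjugated by inversion. Then \<open>?f\<close> is one step along \<open>inv a\<close> or
    \<open>inv (mover L)\<close>, and \<open>?h\<close> adds a second step along
    \<open>inv a\<close>.\<close>
  let ?f = "\<lambda>g. inv (shift L (inv g))"
  let ?h = "\<lambda>g. inv (a \<otimes> shift L (inv g))"
  have "inv (gen L 0) \<in> X" "inv (gen L 1) \<in> X"
    using assms(1) by (auto simp: X_def SET_INV_def)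
  then have X: "inv a \<in> X" "inv (mover L) \<in> X"
    by (simp_all add: gen_def)
  have step: "g \<otimes> x \<in> A" if "g \<in> A - ?B" "x \<in> X" for g x
    using that by (auto simp: inner_boundary_def)
  have "card A \<le> 3 * card ?B"
  proof (rule doubling_boundary)
    show "?B \<subseteq> A" by (auto simp: inner_boundary_def)
    have carr: "inv g \<in> carrier G" "shift L (inv g) \<in> carrier G" "a \<otimes> shift L (inv g) \<in> carrier G"
      if "g \<in> A" for g
      using that A(1) by auto
    have inj: "g = h" if "g \<in> A" "h \<in> A" "shift L (inv g) = shift L (inv h)" for g h
      using inj_onD[OF inv_inj inj_onD[OF inj_on_shift that(3)]] carr that(1,2) A(1) by blast
    show "inj_on ?f A"
      using inj inj_onD[OF inv_inj] carr by (intro inj_onI) blast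
    show "inj_on ?h A"
    proof
      fix g h assume gh: "g \<in> A" "h \<in> A" and "?h g = ?h h"
      then have "a \<otimes> shift L (inv g) = a \<otimes> shift L (inv h)"
        using inj_onD[OF inv_inj] carr by blast
      then show "g = h"
        using inj[OF gh] carr gh by simp
    qed
    have "?f g \<noteq> ?h h" if "g \<in> A" "h \<in> A" for g h
      using inj_onD[OF inv_inj, of "shift L (inv g)" "a \<otimes> shift L (inv h)"] carr that
        shift_neq_a_shift[OF assms(2), of "inv g" "inv h"] by blast
    then show "?f ` A \<inter> ?h ` A = {}"
      by blast
    show "?f g \<in> A" if "g \<in> A - ?B" for g
    proof -
      have g: "g \<in> carrier G" using that A(1) by blast
      have "?f g = g \<otimes> inv a \<or> ?f g = g \<otimes> inv (mover L)"
        using g by (simp add: shift_def inv_mult_group)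
      then show ?thesis using step[OF that] X by metis
    qed
    show "?h g \<in> A" if "g \<in> A - ?B" "?f g \<in> A - ?B" for g
    proof -
      have "?h g = ?f g \<otimes> inv a"
        using carr[of g] that(1) by (simp add: inv_mult_group)
      then show ?thesis using step[OF that(2) X(1)] by metis
    qed
  qed (rule A(2))
  moreover have "card A > 0" using A by (simp add: card_gt_0_iff)
  ultimately show "1 / 3 \<le> real (card (inner_boundary G (gen L ` {..<k} \<union> set_inv (gen L ` {..<k})) A)) / real (card A)"
    by (simp add: X_def field_simps)
qed

theorem free_like_ping_pong:
  assumes "k \<ge> 2"
  shows "free_like k G"
  unfolding free_like_def
proof (intro exI conjI allI impI)
  fix i :: nat
  \<comment> \<open>The offset \<open>3\<close> keeps \<open>L\<close> above \<open>2\<close> for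
    every \<open>i\<close>, as distinctness of the generators requires.\<close>
  show "card (gen (int i + 3) ` {..<k}) = k"
    using inj_gen[of "int i + 3"] by (simp add: card_image inj_on_def)
  have "enat i \<le> enat (nat (int i + 3))" by simp
  also have "\<dots> \<le> cayley_girth G (gen (int i + 3) ` {..<k})"
    by (rule girth_gen) simp
  finally show "enat i \<le> cayley_girth G (gen (int i + 3) ` {..<k})" .
  show "1 / 3 \<le> cayley_cheeger G (gen (int i + 3) ` {..<k})"
    by (rule cheeger_gen) (use assms in auto)
qed (use assms generate_gen in auto)

end

section \<open>Quotients of the free group of rank two\<close>

definition action_kernel :: "'a set \<Rightarrow> ('a \<times> bool \<Rightarrow> 'x \<Rightarrow> 'x) \<Rightarrow> 'a word set"
  where "action_kernel S \<sigma> = {w \<in> reduced_words S. \<forall>x. foldr \<sigma> w x = x}"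

locale letter_action =
  fixes \<sigma> :: "'a \<times> bool \<Rightarrow> 'x \<Rightarrow> 'x"
  assumes inv_letter_action [simp]: "\<sigma> (inv_letter l) (\<sigma> l x) = x"
begin

text \<open>Cancelling letters act by mutually inverse maps, so reduction does not affect the
  action. Hence folding turns free-group multiplication into composition, even for unreduced
  words.\<close>

lemma push_letter_action: "foldr \<sigma> (push_letter l w) x = \<sigma> l (foldr \<sigma> w x)"
  using inv_letter_action[of "inv_letter l"]
  by (cases w) (auto simp: push_letter_def simp del: inv_letter_action)

lemma mult_action [simp]: "foldr \<sigma> (foldr push_letter u v) x = foldr \<sigma> u (foldr \<sigma> v x)"
  by (induction u) (simp_all add: push_letter_action)

lemma pow_action:
  "foldr \<sigma> (u [^]\<^bsub>free_group S\<^esub> (n::nat)) x = (foldr \<sigma> u ^^ n) x"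
  by (induction n arbitrary: x) (simp_all add: funpow_swap1)

lemma inv_action:
  assumes "u \<in> reduced_words S"
  shows "foldr \<sigma> (inv\<^bsub>free_group S\<^esub> u) (foldr \<sigma> u x) = x"
    and "foldr \<sigma> u (foldr \<sigma> (inv\<^bsub>free_group S\<^esub> u) x) = x"
proof -
  interpret F: group "free_group S" by (rule group_free_group)
  have "inv\<^bsub>free_group S\<^esub> u \<otimes>\<^bsub>free_group S\<^esub> u = \<one>\<^bsub>free_group S\<^esub>"
    "u \<otimes>\<^bsub>free_group S\<^esub> inv\<^bsub>free_group S\<^esub> u = \<one>\<^bsub>free_group S\<^esub>"
    using F.l_inv[of u] F.r_inv[of u] assms by simp_all
  then show "foldr \<sigma> (inv\<^bsub>free_group S\<^esub> u) (foldr \<sigma> u x) = x"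
    and "foldr \<sigma> u (foldr \<sigma> (inv\<^bsub>free_group S\<^esub> u) x) = x"
    unfolding free_group_simps mult_action[symmetric] by simp_all
qed

lemma normal_action_kernel: "action_kernel S \<sigma> \<lhd> free_group S"
proof -
  interpret F: group "free_group S" by (rule group_free_group)
  have closed: "foldr push_letter u v \<in> reduced_words S" if "u \<in> reduced_words S" "v \<in> reduced_words S" for u v
    using F.m_closed[of u v] that by simp
  have inv_closed: "inv\<^bsub>free_group S\<^esub> u \<in> reduced_words S" if "u \<in> reduced_words S" for u
    using F.inv_closed[of u] that by simp
  have "subgroup (action_kernel S \<sigma>) (free_group S)"
  proof (rule F.subgroupI)
    fix u assume u: "u \<in> action_kernel S \<sigma>"
    then have "foldr \<sigma> (inv\<^bsub>free_group S\<^esub> u) x = x" for x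
      using inv_action(1)[of u S x] by (simp add: action_kernel_def)
    then show "inv\<^bsub>free_group S\<^esub> u \<in> action_kernel S \<sigma>"
      using u inv_closed by (simp add: action_kernel_def)
  qed (auto simp: action_kernel_def closed intro: exI[of _ "[]"])
  moreover have "u \<otimes>\<^bsub>free_group S\<^esub> v \<otimes>\<^bsub>free_group S\<^esub> inv\<^bsub>free_group S\<^esub> u \<in> action_kernel S \<sigma>"
    if "u \<in> carrier (free_group S)" "v \<in> action_kernel S \<sigma>" for u v
    using that by (auto simp: action_kernel_def closed inv_closed inv_action)
  ultimately show ?thesis
    by (simp only: F.normal_inv_iff) blast
qed

end

lemma normal_normal_closure:
  assumes "group G" "R \<subseteq> carrier G"
  shows "normal_closure G R \<lhd> G" and "R \<subseteq> normal_closure G R"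
proof -
  interpret group G by fact
  have "carrier G \<in> {N. N \<lhd> G \<and> R \<subseteq> N}"
    using assms(2) normal_inv_iff subgroup_self by auto
  then show "normal_closure G R \<lhd> G"
    unfolding normal_closure_def normal_inv_iff
    by (intro conjI subgroups_Inter) auto
  show "R \<subseteq> normal_closure G R"
    by (auto simp: normal_closure_def)
qed

section \<open>Isomorphic copies of quotients and countably many kernels\<close>

lemma countable_group_nat_copy:
  assumes "group H" "countable (carrier H)"
  shows "\<exists>G :: nat monoid. group G \<and> H \<cong> G"
proof -
  interpret H: group H by fact
  define c where "c = to_nat_on (carrier H)"
  define d where "d = from_nat_into (carrier H)"
  have d: "d (c x) = x" if "x \<in> carrier H" for x
    using assms(2) that by (simp add: c_def d_def)
  define G :: "nat monoid"
    where "G = \<lparr>carrier = c ` carrier H, monoid.mult = (\<lambda>x y. c (d x \<otimes>\<^bsub>H\<^esub> d y)), one = c \<one>\<^bsub>H\<^esub>\<rparr>"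
  have hom: "c \<in> hom H G"
    by (auto simp: hom_def G_def d)
  have "inj_on c (carrier H)"
    by (metis d inj_onI)
  then have "c \<in> iso H G"
    using hom by (auto simp: iso_def bij_betw_def G_def)
  moreover have "group G"
    using H.hom_imp_img_group[OF hom] by (simp add: G_def)
  ultimately show ?thesis
    by (auto simp: is_iso_def)
qed

lemma countable_quotient:
  assumes "countable (carrier G)"
  shows "countable (carrier (G Mod N))"
  using assms by (auto simp: FactGroup_def RCOSETS_def)

lemma quotient_projection:
  assumes "group F" "N \<lhd> F" "group G" "F Mod N \<cong> G"
  shows "\<exists>h. h \<in> hom F G \<and> h ` carrier F = carrier G \<and>
    (\<forall>w \<in> carrier F. h w = \<one>\<^bsub>G\<^esub> \<longleftrightarrow> w \<in> N)"
proof -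
  obtain \<psi> where iso: "\<psi> \<in> iso (F Mod N) G"
    using assms(4) unfolding is_iso_def by blast
  define h where "h = (\<lambda>w. \<psi> (N #>\<^bsub>F\<^esub> w))"
  interpret F: group F by fact
  interpret N: normal N F by fact
  interpret Q: group "F Mod N" by (rule N.factorgroup_is_group)
  interpret \<psi>: group_hom "F Mod N" G \<psi>
    using assms(3) iso Q.is_group by (simp add: group_hom_def group_hom_axioms_def iso_def)
  have \<psi>: "inj_on \<psi> (carrier (F Mod N))" "\<psi> ` carrier (F Mod N) = carrier G"
    using iso by (auto simp: iso_def bij_betw_def)
  have carr: "carrier (F Mod N) = (\<lambda>w. N #>\<^bsub>F\<^esub> w) ` carrier F"
    by (auto simp: FactGroup_def RCOSETS_def)
  have "h = \<psi> \<circ> (\<lambda>w. N #>\<^bsub>F\<^esub> w)"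
    by (auto simp: h_def)
  then have "h \<in> hom F G"
    using hom_compose[OF N.r_coset_hom_Mod \<psi>.homh] by simp
  moreover have "h ` carrier F = carrier G"
    using \<psi>(2) carr by (auto simp: h_def image_iff)
  moreover have "h w = \<one>\<^bsub>G\<^esub> \<longleftrightarrow> w \<in> N" if w: "w \<in> carrier F" for w
  proof -
    have "N #>\<^bsub>F\<^esub> w \<in> carrier (F Mod N)"
      using carr w by blast
    then have "h w = \<one>\<^bsub>G\<^esub> \<longleftrightarrow> N #>\<^bsub>F\<^esub> w = \<one>\<^bsub>F Mod N\<^esub>"
      using inj_on_eq_iff[OF \<psi>(1) _ Q.one_closed] \<psi>.hom_one by (simp add: h_def)
    also have "\<dots> \<longleftrightarrow> w \<in> N"
      using F.coset_join1[OF _ w N.subgroup_axioms] F.coset_join2[OF w N.subgroup_axioms]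
      by (auto simp: FactGroup_def)
    finally show ?thesis .
  qed
  ultimately show ?thesis
    by blast
qed

text \<open>A code is a finite presentation with two words for the images of the letters. Its type
  is countable, with relators in a list rather than a set; only the range matters, so meaningless
  codes do no harm.\<close>

definition decode_kernel :: "nat \<times> nat word list \<times> nat word \<times> nat word \<Rightarrow> nat word set"
  where "decode_kernel = (\<lambda>(n, R, u, v).
    let F = free_group {..<n}; K = normal_closure F (set R) in
    {w \<in> reduced_words {..<2}.
      eval_word (F Mod K) (map (apfst (\<lambda>i. K #>\<^bsub>F\<^esub> (if i = 0 then u else v))) w) = \<one>\<^bsub>F Mod K\<^esub>})"

text \<open>Composing \<open>h\<close> with an isomorphism onto the presented quotient keeps the
  kernel. The images of the two letters are then cosets, and representatives of them complete the
  code.\<close>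

lemma kernel_decodable:
  assumes G: "group G" and fp: "finitely_presented G" and h: "h \<in> hom (free_group {..<2}) G"
  shows "{w \<in> reduced_words {..<2}. h w = \<one>\<^bsub>G\<^esub>} \<in> range decode_kernel"
proof -
  obtain n R where R: "finite R" "R \<subseteq> carrier (free_group {..<n::nat})"
    and iso: "free_group {..<n} Mod normal_closure (free_group {..<n}) R \<cong> G"
    using fp unfolding finitely_presented_def by blast
  obtain rs where rs: "set rs = R"
    using finite_list[OF R(1)] by blast
  define F K where "F = free_group {..<n}" and "K = normal_closure F R"
  have K: "K \<lhd> F"
    unfolding K_def F_def by (rule normal_normal_closure(1)[OF group_free_group R(2)])
  have Q: "group (F Mod K)"
    by (rule normal.factorgroup_is_group[OF K])
  have "G \<cong> F Mod K"
    using group.iso_sym[OF Q] iso by (simp add: K_def F_def)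
  then obtain \<phi> where \<phi>: "\<phi> \<in> iso G (F Mod K)"
    unfolding is_iso_def by blast
  interpret \<phi>: group_hom G "F Mod K" \<phi>
    using G Q \<phi> by (simp add: group_hom_def group_hom_axioms_def iso_def)
  have hom: "\<phi> \<circ> h \<in> hom (free_group {..<2}) (F Mod K)"
    using hom_compose[OF h \<phi>.homh] .
  have "\<exists>u. (\<phi> \<circ> h) [(i, True)] = K #>\<^bsub>F\<^esub> u" if "i < 2" for i :: nat
    using hom_in_carrier[OF hom, of "[(i, True)]"] that by (auto simp: FactGroup_def RCOSETS_def)
  from this[of 0] this[of 1] obtain u v
    where uv: "(\<phi> \<circ> h) [(0, True)] = K #>\<^bsub>F\<^esub> u" "(\<phi> \<circ> h) [(1, True)] = K #>\<^bsub>F\<^esub> v"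
    by auto
  have "h w = \<one>\<^bsub>G\<^esub> \<longleftrightarrow>
      eval_word (F Mod K) (map (apfst (\<lambda>i. K #>\<^bsub>F\<^esub> (if i = 0 then u else v))) w) = \<one>\<^bsub>F Mod K\<^esub>"
    if w: "w \<in> reduced_words {..<2}" for w
  proof -
    have hw: "h w \<in> carrier G"
      using hom_in_carrier[OF h, of w] w by simp
    have "map (apfst (\<lambda>i. (\<phi> \<circ> h) [(i, True)])) w = map (apfst (\<lambda>i. K #>\<^bsub>F\<^esub> (if i = 0 then u else v))) w"
    proof (rule map_cong[OF refl])
      fix l assume "l \<in> set w"
      then have "fst l \<in> {..<2}"
        using w by (auto simp: reduced_words_def)
      then have "fst l = 0 \<or> fst l = 1" by auto
      then show "apfst (\<lambda>i. (\<phi> \<circ> h) [(i, True)]) l = apfst (\<lambda>i. K #>\<^bsub>F\<^esub> (if i = 0 then u else v)) l"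
        using uv by (cases l) auto
    qed
    then have "(\<phi> \<circ> h) w = eval_word (F Mod K) (map (apfst (\<lambda>i. K #>\<^bsub>F\<^esub> (if i = 0 then u else v))) w)"
      using hom_free_group_eval_word[OF Q hom w] by (simp only:)
    moreover have "(\<phi> \<circ> h) w = \<one>\<^bsub>F Mod K\<^esub> \<longleftrightarrow> h w = \<one>\<^bsub>G\<^esub>"
      using inj_on_eq_iff[of \<phi> "carrier G" "h w" "\<one>\<^bsub>G\<^esub>"] \<phi> hw \<phi>.hom_one
      by (simp add: iso_def bij_betw_def)
    ultimately show ?thesis by simp
  qed
  then have "{w \<in> reduced_words {..<2}. h w = \<one>\<^bsub>G\<^esub>} = decode_kernel (n, rs, u, v)"
    unfolding decode_kernel_def Let_def prod.case rs F_def[symmetric] K_def[symmetric] by blast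
  then show ?thesis by blast
qed

section \<open>The two examples\<close>

fun lattice_step :: "nat \<times> bool \<Rightarrow> int \<times> int \<Rightarrow> int \<times> int"
  where "lattice_step (i, e) (x, y) =
    (if i = 0 then (if e then x + 4 * y else x - 4 * y, y)
     else if e then (- y, x - y) else (y - x, - x))"

interpretation lattice: letter_action lattice_step
  by unfold_locales (auto simp: inv_letter_def split: prod.splits)

definition narrow :: "(int \<times> int) set"
  where "narrow = {(x, y). \<bar>x\<bar> < 2 * \<bar>y\<bar>}"

text \<open>The origin is a fixed point outside \<open>narrow\<close> and would break ping-pong;
  invertibility of the letters keeps other orbits away from it.\<close>

lemma lattice_nonzero: "p \<noteq> (0, 0) \<Longrightarrow> foldr lattice_step w p \<noteq> (0, 0)"
proof (induction w)
  case (Cons l w)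
  then show ?case
    by (cases l; cases "foldr lattice_step w p") (auto split: if_splits)
qed simp

lemma lattice_step_1_narrow:
  "p \<noteq> (0, 0) \<Longrightarrow> p \<notin> narrow \<Longrightarrow> lattice_step (1, e) p \<in> narrow"
proof -
  assume "p \<noteq> (0, 0)" "p \<notin> narrow"
  then obtain x y where p: "p = (x, y)" "2 * \<bar>y\<bar> \<le> \<bar>x\<bar>" "\<bar>x\<bar> > 0"
    by (cases p) (auto simp: narrow_def)
  have "\<bar>x\<bar> \<le> \<bar>x - y\<bar> + \<bar>y\<bar>" "\<bar>y - x\<bar> \<le> \<bar>x\<bar> + \<bar>y\<bar>" by linarith+
  then have "\<bar>y\<bar> < 2 * \<bar>x - y\<bar>" "\<bar>y - x\<bar> < 2 * \<bar>x\<bar>" using p(2,3) by linarith+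
  then show ?thesis
    by (simp add: p(1) narrow_def)
qed

lemma lattice_pow:
  "foldr lattice_step ([(0, True)] [^]\<^bsub>free_group {..<2::nat}\<^esub> (n::int)) (x, y) = (x + 4 * n * y, y)"
proof -
  interpret F: group "free_group {..<2::nat}" by (rule group_free_group)
  have nat: "foldr lattice_step ([(0, True)] [^]\<^bsub>free_group {..<2::nat}\<^esub> (n::nat)) (x, y) = (x + 4 * int n * y, y)"
    for n x y
    unfolding lattice.pow_action by (induction n) (auto simp: algebra_simps)
  show ?thesis
  proof (cases n)
    case (nonneg m)
    then show ?thesis using nat[of m x y] by (simp add: int_pow_int)
  next
    case (neg m)
    define u where "u = [(0, True)] [^]\<^bsub>free_group {..<2::nat}\<^esub> Suc m"
    have u: "u \<in> reduced_words {..<2::nat}"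
      using F.nat_pow_closed[of "[(0, True)]" "Suc m"] by (simp add: u_def)
    have "foldr lattice_step u (x + 4 * n * y, y) = (x, y)"
      unfolding u_def nat by (simp add: neg algebra_simps)
    then have "foldr lattice_step (inv\<^bsub>free_group {..<2::nat}\<^esub> u) (x, y) = (x + 4 * n * y, y)"
      using lattice.inv_action(1)[OF u, of "(x + 4 * n * y, y)"] by simp
    then show ?thesis
      unfolding u_def neg by (subst F.int_pow_neg_int) simp_all
  qed
qed

text \<open>The shear displaces \<open>x\<close> by at least \<open>4\<bar>y\<bar>\<close>, twice
  the bound \<open>2\<bar>y\<bar>\<close> on its initial size; hence the coefficient
  \<open>4\<close>.\<close>

lemma lattice_pow_narrow:
  assumes "n \<noteq> 0" "p \<in> narrow"
  shows "foldr lattice_step ([(0, True)] [^]\<^bsub>free_group {..<2::nat}\<^esub> (n::int)) p \<notin> narrow"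
proof -
  obtain x y where p: "p = (x, y)" by (cases p)
  have "1 * \<bar>y\<bar> \<le> \<bar>n\<bar> * \<bar>y\<bar>"
    using assms(1) by (intro mult_right_mono) auto
  then have "4 * \<bar>y\<bar> \<le> \<bar>4 * n * y\<bar>"
    by (simp add: abs_mult)
  then have "2 * \<bar>y\<bar> \<le> \<bar>x + 4 * n * y\<bar>"
    using assms(2) p by (auto simp: narrow_def)
  then show ?thesis
    unfolding p lattice_pow by (simp add: narrow_def)
qed

text \<open>Membership in \<open>W\<close> is read off from the orbit of \<open>(0, 1)\<close>. This
  is well defined on \<open>G\<close> because the kernel of \<open>h\<close> acts trivially on the
  lattice.\<close>

lemma ping_pong_quotient:
  fixes h :: "nat word \<Rightarrow> 'g"
  assumes G: "group G" and h: "h \<in> hom (free_group {..<2}) G" "h ` reduced_words {..<2} = carrier G"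
    and ker: "\<And>w. w \<in> reduced_words {..<2} \<Longrightarrow> h w = \<one>\<^bsub>G\<^esub> \<Longrightarrow> w \<in> action_kernel {..<2} lattice_step"
  shows "ping_pong_group G (h [(0, True)]) (h [(1, True)])
    (h ` {w \<in> reduced_words {..<2}. foldr lattice_step w (0, 1) \<in> narrow})"
    (is "ping_pong_group G ?a ?b ?W")
proof -
  let ?F = "free_group {..<2::nat}"
  interpret F: group ?F by (rule group_free_group)
  interpret G: group G by fact
  interpret group_hom ?F G h
    using h by unfold_locales
  let ?p = "\<lambda>w. foldr lattice_step w (0, 1)"
  have eq: "?p u = ?p v" if "u \<in> reduced_words {..<2}" "v \<in> reduced_words {..<2}" "h u = h v" for u v
  proof -
    have "h (u \<otimes>\<^bsub>?F\<^esub> inv\<^bsub>?F\<^esub> v) = \<one>\<^bsub>G\<^esub>"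
      using that hom_mult[of u "inv\<^bsub>?F\<^esub> v"] hom_inv[of v] F.inv_closed[of v] hom_closed[of v] by simp
    then have "u \<otimes>\<^bsub>?F\<^esub> inv\<^bsub>?F\<^esub> v \<in> action_kernel {..<2} lattice_step"
      using ker F.m_closed[of u "inv\<^bsub>?F\<^esub> v"] F.inv_closed[of v] that by simp
    then have "foldr lattice_step (u \<otimes>\<^bsub>?F\<^esub> inv\<^bsub>?F\<^esub> v) (?p v) = ?p v"
      unfolding action_kernel_def mem_Collect_eq by (rule conjunct2[THEN spec])
    then have "foldr lattice_step u (foldr lattice_step (inv\<^bsub>?F\<^esub> v) (?p v)) = ?p v"
      by (simp only: free_group_simps lattice.mult_action)
    then show ?thesis
      using lattice.inv_action(1)[OF that(2)] by simp
  qed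
  define V where "V = h ` {w \<in> reduced_words {..<2}. ?p w \<in> narrow}"
  have W: "h w \<in> V \<longleftrightarrow> ?p w \<in> narrow" if w: "w \<in> reduced_words {..<2}" for w
  proof
    assume "h w \<in> V"
    then obtain v where v: "v \<in> reduced_words {..<2}" "?p v \<in> narrow" "h w = h v"
      unfolding V_def by blast
    then show "?p w \<in> narrow"
      using eq[OF w v(1) v(3)] by simp
  qed (use w in \<open>simp add: V_def\<close>)
  have sur: "\<exists>w \<in> reduced_words {..<2}. g = h w" if "g \<in> carrier G" for g
    using h(2) that by blast
  have letters: "[(0, True)] \<in> carrier ?F" "[(1, e)] \<in> carrier ?F" for e
    by simp_all
  have inv_b: "inv\<^bsub>G\<^esub> ?b = h [(1, False)]"
    using hom_inv[OF letters(2)[of True]] by (simp add: inv_letter_free_group)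
  have mult: "h u \<otimes>\<^bsub>G\<^esub> h v = h (foldr push_letter u v)" "foldr push_letter u v \<in> reduced_words {..<2}"
    if "u \<in> reduced_words {..<2}" "v \<in> reduced_words {..<2}" for u v
    using hom_mult[of u v] F.m_closed[of u v] that by simp_all
  have b: "h [(1, e)] \<otimes>\<^bsub>G\<^esub> g \<in> V" if g: "g \<in> carrier G" "g \<notin> V" for g e
  proof -
    obtain w where w: "w \<in> reduced_words {..<2}" "g = h w" using sur[OF g(1)] by blast
    have "?p w \<notin> narrow" using W[OF w(1)] g(2) w(2) by simp
    then have "lattice_step (1, e) (?p w) \<in> narrow"
      by (intro lattice_step_1_narrow lattice_nonzero) simp_all
    then show ?thesis
      using W mult[of "[(1, e)]" w] letters(2)[of e] w
      by (simp add: lattice.push_letter_action del: lattice_step.simps)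
  qed
  show ?thesis
    unfolding V_def[symmetric]
  proof
    show "?a \<in> carrier G" "?b \<in> carrier G"
      using letters by (auto intro: hom_closed)
    show "generate G {?a, ?b} = carrier G"
    proof
      show "generate G {?a, ?b} \<subseteq> carrier G"
        using letters by (intro G.generate_incl) (auto intro: hom_closed)
      show "carrier G \<subseteq> generate G {?a, ?b}"
      proof
        fix g assume "g \<in> carrier G"
        then obtain w where w: "w \<in> reduced_words {..<2}" "g = h w" using sur by blast
        then have "g = eval_word G (map (apfst (\<lambda>i. h [(i, True)])) w)"
          using hom_free_group_eval_word[OF G h(1)] by simp
        moreover have "fst ` set (map (apfst (\<lambda>i. h [(i, True)])) w) \<subseteq> {?a, ?b}"
          using w(1) by (auto simp: reduced_words_def less_2_cases_iff)
        ultimately show "g \<in> generate G {?a, ?b}"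
          using G.eval_word_in_generate by simp
      qed
    qed
    have "[] \<in> reduced_words {..<2}" by simp
    then show "\<one>\<^bsub>G\<^esub> \<in> V"
      using W[of "[]"] hom_one by (simp add: narrow_def)
    fix g assume g: "g \<in> carrier G"
    show "?a [^]\<^bsub>G\<^esub> n \<otimes>\<^bsub>G\<^esub> g \<notin> V" if "g \<in> V" "n \<noteq> 0" for n :: int
    proof -
      obtain w where w: "w \<in> reduced_words {..<2}" "g = h w" using sur[OF g] by blast
      let ?u = "[(0, True)] [^]\<^bsub>?F\<^esub> n"
      have u: "?u \<in> reduced_words {..<2}"
        using F.int_pow_closed[OF letters(1)] by simp
      have "?p w \<in> narrow" using W[OF w(1)] that(1) w(2) by simp
      then have "?p (foldr push_letter ?u w) \<notin> narrow"
        using lattice_pow_narrow[OF that(2)] by simp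
      then show ?thesis
        using W mult[OF u w(1)] w(2) hom_int_pow[OF letters(1)] by simp
    qed
    show "?b \<otimes>\<^bsub>G\<^esub> g \<in> V" if "g \<notin> V"
      using b[OF g that] .
    show "inv\<^bsub>G\<^esub> ?b \<otimes>\<^bsub>G\<^esub> g \<in> V" if "g \<notin> V"
      unfolding inv_b using b[OF g that] .
  qed
qed

text \<open>Both examples use this criterion. The exponent \<open>6\<close> covers \<open>b\<close>
  of order three on the lattice and two on the copies of the integers; \<open>b\<close> stays
  nontrivial because it moves lattice points.\<close>

lemma quotient_free_like:
  assumes N: "N \<lhd> free_group {..<2::nat}" "N \<subseteq> action_kernel {..<2} lattice_step"
    and b6: "[(1, True)] [^]\<^bsub>free_group {..<2::nat}\<^esub> (6::nat) \<in> N"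
  shows "\<exists>G :: nat monoid. group G \<and> free_group {..<2::nat} Mod N \<cong> G \<and> n_generated 2 G \<and>
    \<not> is_free_group G \<and> (\<forall>k\<ge>2. free_like k G)"
proof -
  let ?F = "free_group {..<2::nat}"
  interpret F: group ?F by (rule group_free_group)
  have "group (?F Mod N)"
    using N(1) by (rule normal.factorgroup_is_group)
  moreover have "countable (carrier (?F Mod N))"
    by (rule countable_quotient) simp
  ultimately obtain G :: "nat monoid" where G: "group G" and iso: "?F Mod N \<cong> G"
    using countable_group_nat_copy by blast
  obtain h where "h \<in> hom ?F G \<and> h ` carrier ?F = carrier G \<and>
    (\<forall>w \<in> carrier ?F. h w = \<one>\<^bsub>G\<^esub> \<longleftrightarrow> w \<in> N)"
    using quotient_projection[OF group_free_group N(1) G iso] by (rule exE)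
  then have h: "h \<in> hom ?F G" "h ` carrier ?F = carrier G"
    "\<And>w. w \<in> carrier ?F \<Longrightarrow> h w = \<one>\<^bsub>G\<^esub> \<longleftrightarrow> w \<in> N"
    by simp_all
  interpret h: group_hom ?F G h
    using G h(1) by (simp add: group_hom_def group_hom_axioms_def group_free_group)
  interpret P: ping_pong_group G "h [(0, True)]" "h [(1, True)]"
    "h ` {w \<in> reduced_words {..<2}. foldr lattice_step w (0, 1) \<in> narrow}"
    using h N(2) G by (intro ping_pong_quotient) auto
  have "[(1, True)] \<notin> action_kernel {..<2::nat} lattice_step"
    by (auto simp: action_kernel_def intro!: exI[of _ 1])
  then have "h [(1, True)] \<noteq> \<one>\<^bsub>G\<^esub>"
    using h(3)[of "[(1, True)]"] N(2) by auto
  moreover have "h [(1, True)] [^]\<^bsub>G\<^esub> Suc 5 = \<one>\<^bsub>G\<^esub>"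
    using h(3)[of "[(1, True)] [^]\<^bsub>?F\<^esub> (6::nat)"] b6 h.hom_nat_pow[of "[(1, True)]" 6]
      F.nat_pow_closed[of "[(1, True)]" 6] by (simp del: nat_pow_Suc)
  ultimately have "\<not> is_free_group G"
    using not_free_if_torsion[OF G P.b] by blast
  moreover have "n_generated 2 G"
    unfolding n_generated_def
    using P.a P.b P.generate_ab by (intro exI[of _ "{h [(0, True)], h [(1, True)]}"]) (auto simp: card_insert_if)
  ultimately show ?thesis
    using G iso P.free_like_ping_pong by blast
qed

text \<open>The left summand keeps the kernel inside the lattice kernel; the right one records
  \<open>S\<close>. There \<open>b\<close> and its inverse act alike, a transposition being its own
  inverse.\<close>

fun block_step :: "nat set \<Rightarrow> nat \<times> bool \<Rightarrow> (int \<times> int) + (nat \<times> int) \<Rightarrow> (int \<times> int) + (nat \<times> int)"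
  where
    "block_step S l (Inl p) = Inl (lattice_step l p)"
  | "block_step S (i, e) (Inr (m, x)) =
      Inr (m, if i = 0 then (if e then x + 1 else x - 1)
              else if m \<in> S then transpose 0 (int m + 1) x else x)"

interpretation block: letter_action "block_step S" for S
proof
  fix l :: "nat \<times> bool" and p :: "(int \<times> int) + (nat \<times> int)"
  show "block_step S (inv_letter l) (block_step S l p) = p"
    by (cases l; cases p) (auto simp: inv_letter_def)
qed

lemma foldr_block_step_Inl: "foldr (block_step S) w (Inl p) = Inl (foldr lattice_step w p)"
  by (induction w) auto

lemma block_kernel_subset: "action_kernel T (block_step S) \<subseteq> action_kernel T lattice_step"
proof
  fix w assume w: "w \<in> action_kernel T (block_step S)"
  then have "foldr (block_step S) w (Inl p) = Inl p" for p
    unfolding action_kernel_def by simp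
  then show "w \<in> action_kernel T lattice_step"
    using w by (simp add: action_kernel_def foldr_block_step_Inl)
qed

section \<open>Relators that detect membership in \<open>S\<close>\<close>

definition half_relator :: "nat \<Rightarrow> nat word"
  where "half_relator n =
    replicate 3 (1, True) @ replicate (Suc n) (0, False) @ replicate 3 (1, True) @ replicate (Suc n) (0, True)"

text \<open>
  The square of the product of \<open>b\<^sup>3\<close> and its conjugate by \<open>a\<^bsup>n+1\<^esup>\<close>; since \<open>b\<^sup>3\<close> acts as an involution,
  the square acts trivially iff the two commute. Pushing the letters onto the empty word reduces it.
\<close>

definition relator :: "nat \<Rightarrow> nat word"
  where "relator n = foldr push_letter (half_relator n @ half_relator n) []"

lemma relator_reduced: "relator n \<in> reduced_words {..<2}"
  unfolding relator_def
  by (rule foldr_push_letter_closed) (auto simp: half_relator_def)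

lemma relator_action:
  "foldr (block_step S) (relator n) p
    = foldr (block_step S) (half_relator n) (foldr (block_step S) (half_relator n) p)"
  unfolding relator_def by simp

lemma foldr_replicate: "foldr f (replicate n l) x = (f l ^^ n) x"
  by (induction n) auto

lemma b_cubed_lattice: "(lattice_step (Suc 0, True) ^^ 3) p = p"
  by (cases p) (simp add: numeral_3_eq_3)

lemma lattice_shift: "(lattice_step (0, e) ^^ n) (x, y) = (if e then x + 4 * int n * y else x - 4 * int n * y, y)"
  by (induction n) (auto simp: algebra_simps)

lemma block_shift: "(block_step S (0, e) ^^ n) (Inr (m, x)) = Inr (m, if e then x + int n else x - int n)"
  by (induction n) auto

lemma b_cubed_block:
  "(block_step S (Suc 0, True) ^^ 3) (Inr (m, x)) = Inr (m, if m \<in> S then transpose 0 (int m + 1) x else x)"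
  by (simp add: numeral_3_eq_3)

text \<open>On the lattice \<open>b^3\<close> is trivial, and the remaining powers of
  \<open>a\<close> cancel.\<close>

lemma half_relator_lattice: "foldr lattice_step (half_relator n) p = p"
  by (cases p)
    (simp add: half_relator_def foldr_replicate lattice_shift b_cubed_lattice
      del: replicate_Suc funpow.simps lattice_step.simps)

lemma half_relator_block:
  "foldr (block_step S) (half_relator n) (Inr (m, x)) = Inr (m,
    if m \<in> S then transpose 0 (int m + 1) (transpose 0 (int m + 1) (x + int (Suc n)) - int (Suc n)) else x)"
  by (simp add: half_relator_def foldr_replicate block_shift b_cubed_block
      del: replicate_Suc funpow.simps block_step.simps)

text \<open>On copy \<open>m\<close> in \<open>S\<close> the transpositions have supports
  \<open>{0, m + 1}\<close> and \<open>{-(n + 1), m - n}\<close>. These are disjoint unless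
  \<open>m = n\<close>; then they share only \<open>0\<close>, and the product is a 3-cycle with
  nontrivial square.\<close>

lemma relator_in_kernel_iff: "relator n \<in> action_kernel {..<2} (block_step S) \<longleftrightarrow> n \<notin> S"
proof
  assume ker: "relator n \<in> action_kernel {..<2} (block_step S)"
  show "n \<notin> S"
  proof
    assume "n \<in> S"
    \<comment> \<open>The two halves carry \<open>0\<close> to \<open>-(n + 1)\<close> and then to
      \<open>n + 1\<close>.\<close>
    then have "foldr (block_step S) (relator n) (Inr (n, 0)) = Inr (n, int n + 1)"
      by (simp add: relator_action half_relator_block transpose_def)
    then show False
      using ker by (simp add: action_kernel_def)
  qed
next
  assume n: "n \<notin> S"
  have "foldr (block_step S) (relator n) p = p" for p
  proof (cases p)
    case (Inl q)
    show ?thesis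
      unfolding Inl relator_action by (simp only: foldr_block_step_Inl half_relator_lattice)
  next
    case (Inr q)
    then show ?thesis
      using n by (cases q) (auto simp: relator_action half_relator_block transpose_def)
  qed
  then show "relator n \<in> action_kernel {..<2} (block_step S)"
    by (simp add: action_kernel_def relator_reduced)
qed

text \<open>\<open>b^3\<close> is trivial on the lattice and an involution on each copy of the
  integers.\<close>

lemma b_pow_six_kernel:
  "[(1, True)] [^]\<^bsub>free_group {..<2::nat}\<^esub> (6::nat) \<in> action_kernel {..<2} (block_step S)"
proof -
  interpret F: group "free_group {..<2::nat}" by (rule group_free_group)
  have "(block_step S (Suc 0, True) ^^ 3) ((block_step S (Suc 0, True) ^^ 3) p) = p" for p
  proof (cases p)
    case (Inl q)
    have "(block_step S (Suc 0, True) ^^ 3) (Inl q) = Inl ((lattice_step (Suc 0, True) ^^ 3) q)" for q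
      by (simp add: numeral_3_eq_3)
    then show ?thesis
      using Inl by (simp only: b_cubed_lattice)
  next
    case (Inr q)
    then show ?thesis
      by (cases q) (simp add: b_cubed_block)
  qed
  then have "(block_step S (Suc 0, True) ^^ 6) p = p" for p
    using funpow_add[of 3 3 "block_step S (Suc 0, True)"] by simp
  then have "foldr (block_step S) ([(1, True)] [^]\<^bsub>free_group {..<2::nat}\<^esub> (6::nat)) p = p" for p
    unfolding block.pow_action by simp
  moreover have "[(1, True)] [^]\<^bsub>free_group {..<2::nat}\<^esub> (6::nat) \<in> reduced_words {..<2::nat}"
    using F.nat_pow_closed[of "[(1, True)]" 6] by simp
  ultimately show ?thesis
    unfolding action_kernel_def by blast
qed

lemma ex_finitely_presented:
  "\<exists>G :: nat monoid. group G \<and> n_generated 2 G \<and> finitely_presented G \<and>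
     \<not> is_free_group G \<and> (\<forall>k\<ge>2. free_like k G)"
proof -
  let ?F = "free_group {..<2::nat}"
  interpret F: group ?F by (rule group_free_group)
  let ?b = "[(1, True)] :: nat word"
  define R where "R = {?b [^]\<^bsub>?F\<^esub> (3::nat)}"
  have R: "R \<subseteq> carrier ?F"
    using F.nat_pow_closed[of ?b 3] by (simp add: R_def)
  define N where "N = normal_closure ?F R"
  have N: "N \<lhd> ?F" "R \<subseteq> N"
    unfolding N_def by (rule normal_normal_closure[OF group_free_group R])+
  have "foldr lattice_step (?b [^]\<^bsub>?F\<^esub> (3::nat)) p = p" for p
    using b_cubed_lattice[of p] unfolding lattice.pow_action by simp
  then have "R \<subseteq> action_kernel {..<2} lattice_step"
    using R by (simp add: R_def action_kernel_def)
  \<comment> \<open>The lattice kernel is itself a normal subgroup containing \<open>R\<close>, so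
    it contains the normal closure.\<close>
  then have sub: "N \<subseteq> action_kernel {..<2} lattice_step"
    unfolding N_def normal_closure_def
    by (intro Inter_lower CollectI conjI lattice.normal_action_kernel)
  have "?b [^]\<^bsub>?F\<^esub> (6::nat) = ?b [^]\<^bsub>?F\<^esub> (3::nat) \<otimes>\<^bsub>?F\<^esub> ?b [^]\<^bsub>?F\<^esub> (3::nat)"
    using F.nat_pow_mult[of ?b 3 3] by simp
  then have "?b [^]\<^bsub>?F\<^esub> (6::nat) \<in> N"
    using N(2) subgroup.m_closed[OF normal_imp_subgroup[OF N(1)]] by (simp add: R_def)
  from quotient_free_like[OF N(1) sub this]
  obtain G :: "nat monoid" where G: "group G" "?F Mod N \<cong> G" "n_generated 2 G"
    "\<not> is_free_group G" "\<forall>k\<ge>2. free_like k G"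
    by blast
  have "finitely_presented G"
    unfolding finitely_presented_def
    using G(2) R by (intro exI[of _ 2] exI[of _ R]) (simp add: R_def N_def)
  then show ?thesis
    using G by blast
qed

text \<open>A counting argument that names no particular \<open>S\<close>: if all these quotients
  were finitely presented, every kernel would have a code, although the relators separate the
  uncountably many sets \<open>S\<close>.\<close>

lemma ex_not_finitely_presented:
  "\<exists>G :: nat monoid. group G \<and> n_generated 2 G \<and> \<not> finitely_presented G \<and>
     \<not> is_free_group G \<and> (\<forall>k\<ge>2. free_like k G)"
proof (rule ccontr)
  assume none: "\<not> ?thesis"
  let ?N = "\<lambda>S. action_kernel {..<2::nat} (block_step S)"
  have "?N S \<in> range decode_kernel" for S
  proof -
    obtain G :: "nat monoid" where G: "group G" "free_group {..<2::nat} Mod ?N S \<cong> G" "n_generated 2 G"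
      "\<not> is_free_group G" "\<forall>k\<ge>2. free_like k G"
      using quotient_free_like[OF block.normal_action_kernel block_kernel_subset b_pow_six_kernel] by blast
    then have fp: "finitely_presented G"
      using none by blast
    obtain h where "h \<in> hom (free_group {..<2}) G \<and> h ` carrier (free_group {..<2}) = carrier G \<and>
      (\<forall>w \<in> carrier (free_group {..<2}). h w = \<one>\<^bsub>G\<^esub> \<longleftrightarrow> w \<in> ?N S)"
      using quotient_projection[OF group_free_group block.normal_action_kernel G(1,2)] by (rule exE)
    then have h: "h \<in> hom (free_group {..<2}) G"
      "\<And>w. w \<in> reduced_words {..<2} \<Longrightarrow> h w = \<one>\<^bsub>G\<^esub> \<longleftrightarrow> w \<in> ?N S"
      by simp_all
    then have "{w \<in> reduced_words {..<2}. h w = \<one>\<^bsub>G\<^esub>} = ?N S"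
      by (auto simp: action_kernel_def)
    then show ?thesis
      using kernel_decodable[OF G(1) fp h(1)] by simp
  qed
  then have "range ?N \<subseteq> range decode_kernel"
    by blast
  then have "countable (range ?N)"
    by (rule countable_subset) simp
  moreover have "inj ?N"
  proof
    fix S T assume "?N S = ?N T"
    then have "n \<notin> S \<longleftrightarrow> n \<notin> T" for n
      using relator_in_kernel_iff[of n S] relator_in_kernel_iff[of n T] by simp
    then show "S = T" by blast
  qed
  ultimately have "countable (UNIV :: nat set set)"
    by (rule countable_image_inj_on)
  then obtain f :: "nat \<Rightarrow> nat set" where "range f = UNIV"
    using uncountable_def[of "UNIV :: nat set set"] by auto
  then show False
    using Cantors_theorem[of "UNIV :: nat set"] by auto
qed

theorem theorem1:
  shows "(\<exists>G :: nat monoid. group G \<and> n_generated 2 G \<and> finitely_presented G \<and>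
            \<not> is_free_group G \<and> (\<forall>k\<ge>2. free_like k G)) \<and>
         (\<exists>G :: nat monoid. group G \<and> n_generated 2 G \<and> \<not> finitely_presented G \<and>
            \<not> is_free_group G \<and> (\<forall>k\<ge>2. free_like k G))"
  using ex_finitely_presented ex_not_finitely_presented by blast

end
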